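(* Let $\mathbf{X}\in\mathbb{R}^{n\times p}$ have rank $p$, let $\mathbf{y}\in\mathbb{R}^n$, $\sigma^2>0$, and let $w_n=2$ (AIC) or $w_n=\log(n)$ (BIC). Let $\lambda_0>\lambda_1>\cdots>\lambda_K=0$ be the transition points of the lasso for $\mathbf{y}$. To find $$\lambda(\text{optimal})=\arg\min_{\lambda\ge0}\ \frac{\|\mathbf{y}-\hat{\boldsymbol{\mu}}_\lambda\|^2}{n\sigma^2}+\frac{w_n}{n}\widehat{df}(\lambda)$$ it suffices to solve $$m^*=\arg\min_{m\in\{0,\dots,K\}}\ \frac{\|\mathbf{y}-\hat{\boldsymbol{\mu}}_{\lambda_m}\|^2}{n\sigma^2}+\frac{w_n}{n}\widehat{df}(\lambda_m);$$ then $\lambda(\text{optimal})=\lambda_{m^*}$. That is, if $m^*$ minimizes the second criterion over $m\in\{0,\dots,K\}$, then $\lambda_{m^*}$ minimizes the first criterion over all $\lambda\ge 0$.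
   Context: For $\lambda\ge 0$, the lasso estimate is $\hat\beta(\lambda)=\arg\min_{\beta\in\mathbb{R}^p}\|\mathbf{y}-\mathbf{X}\beta\|^2+\lambda\sum_{j=1}^p|\beta_j|$ (unique since $\mathbf{X}$ has full column rank), the lasso fit is $\hat{\boldsymbol{\mu}}_\lambda=\mathbf{X}\hat\beta(\lambda)$, the active set is $\mathcal{B}(\lambda)=\{j:\hat\beta(\lambda)_j\neq0\}$, and $\widehat{df}(\lambda)=|\mathcal{B}(\lambda)|$. Transition points: for a given $\mathbf{y}$ there is a finite sequence $\lambda_0>\lambda_1>\cdots>\lambda_K=0$, consisting of $0$ together with all $\lambda>0$ at which the active set changes (i.e. $\mathcal{B}(\cdot)$ is not constant on any neighborhood of $\lambda$). The active set and the signs of the nonzero coefficients are constant on each open interval $(\lambda_{m+1},\lambda_m)$, and $\hat\beta(\lambda)=0$ for $\lambda>\lambda_0$. *)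

theory Defs
  imports "HOL-Analysis.Analysis"
begin

text \<open>
  The design matrix \<^term>\<open>X :: real^'p^'n\<close> has rows indexed by \<^typ>\<open>'n\<close> (observations) and
  columns indexed by \<^typ>\<open>'p\<close> (predictors).
\<close>

definition lasso_objective :: "real^'p^'n \<Rightarrow> real^'n \<Rightarrow> real \<Rightarrow> real^'p \<Rightarrow> real" where
  "lasso_objective X y l b = (norm (y - X *v b))\<^sup>2 + l * (\<Sum>j\<in>UNIV. \<bar>b $ j\<bar>)"

text \<open>
  \<^const>\<open>arg_min\<close> picks some minimizer. It is the unique one when \<^term>\<open>X\<close> has full column rank
  and \<open>l \<ge> 0\<close>; the value is meaningless for \<open>l < 0\<close>.
\<close>

definition lasso :: "real^'p^'n \<Rightarrow> real^'n \<Rightarrow> real \<Rightarrow> real^'p" where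
  "lasso X y l = arg_min (lasso_objective X y l) (\<lambda>_. True)"

definition lasso_fit :: "real^'p^'n \<Rightarrow> real^'n \<Rightarrow> real \<Rightarrow> real^'n" where
  "lasso_fit X y l = X *v lasso X y l"

definition active_set :: "real^'p^'n \<Rightarrow> real^'n \<Rightarrow> real \<Rightarrow> 'p set" where
  "active_set X y l = {j. lasso X y l $ j \<noteq> 0}"

definition df_hat :: "real^'p^'n \<Rightarrow> real^'n \<Rightarrow> real \<Rightarrow> nat" where
  "df_hat X y l = card (active_set X y l)"

text \<open>
  Since \<open>l > 0\<close>, any neighbourhood of \<open>l\<close> can be shrunk to lie in the positive reals, so the
  arbitrary values of \<^const>\<open>lasso\<close> at negative arguments do not matter below.
\<close>

definition transition_points :: "real^'p^'n \<Rightarrow> real^'n \<Rightarrow> real set" where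
  "transition_points X y =
     insert 0 {l. l > 0 \<and> (\<forall>U. open U \<and> l \<in> U \<longrightarrow> \<not> active_set X y constant_on U)}"

text \<open>
  The model selection criterion with weight \<open>w\<close>; the sample size is \<open>CARD('n)\<close>.
\<close>

definition lasso_criterion ::
    "real^'p^'n \<Rightarrow> real^'n \<Rightarrow> real \<Rightarrow> real \<Rightarrow> real \<Rightarrow> real" where
  "lasso_criterion X y \<sigma> w l =
     (norm (y - lasso_fit X y l))\<^sup>2 / (real CARD('n) * \<sigma>\<^sup>2)
       + w / real CARD('n) * real (df_hat X y l)"

end

theory Submission
  imports Defs
begin

text \<open>
  The residual sum of squares is nondecreasing in \<open>l\<close>, and the lasso path is Lipschitz in \<open>l\<close>
  because the objective grows quadratically around its minimizer. Given a penalty \<open>l\<close>, let \<open>t\<close> be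
  the largest transition point with \<open>t \<le> l\<close>. By continuity the coefficients that are nonzero at
  \<open>t\<close> stay nonzero just to the right of \<open>t\<close>, where the active set is already that of \<open>l\<close>; so
  passing from \<open>l\<close> to \<open>t\<close> increases neither term of the criterion.
\<close>

text \<open>Injectivity makes the objective coercive: far from the origin the squared residual alone
  is at least the value of the objective at 0, so a minimizer over a compact ball is a global
  one.\<close>

lemma lasso_minimizer_exists:
  fixes X :: "real^'p^'n"
  assumes inj: "inj ((*v) X)" and l: "l \<ge> 0"
  shows "\<exists>b. is_arg_min (lasso_objective X y l) (\<lambda>_. True) b"
proof -
  obtain B where B: "B > 0" "\<And>v. B * norm v \<le> norm (X *v v)"
    using linear_inj_bounded_below_pos[OF matrix_vector_mul_linear inj] by blast
  \<comment> \<open>Outside this radius \<open>X *v c\<close> is longer than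
    \<open>2 * norm y\<close>, so the residual is at least \<open>norm y\<close>.\<close>
  define R where "R = 2 * norm y / B"
  have R: "R \<ge> 0" using B(1) by (simp add: R_def)
  have "continuous_on (cball 0 R) (lasso_objective X y l)"
    unfolding lasso_objective_def
    by (intro continuous_intros linear_continuous_on_compose matrix_vector_mul_linear)
  then obtain b where b: "\<And>c. c \<in> cball 0 R \<Longrightarrow> lasso_objective X y l b \<le> lasso_objective X y l c"
    using continuous_attains_inf[OF compact_cball, of 0 R] R by fastforce
  have "lasso_objective X y l b \<le> lasso_objective X y l c" for c
  proof (cases "c \<in> cball 0 R")
    case False
    then have "2 * norm y < B * norm c"
      using B(1) by (simp add: R_def field_simps)
    then have "norm y \<le> norm (y - X *v c)"
      using B(2)[of c] norm_triangle_ineq2[of "X *v c" y] by (simp add: norm_minus_commute)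
    then have "(norm y)\<^sup>2 \<le> (norm (y - X *v c))\<^sup>2" by (intro power_mono) auto
    moreover have "0 \<le> l * (\<Sum>j\<in>UNIV. \<bar>c $ j\<bar>)" using l by (simp add: sum_nonneg)
    ultimately have "(norm y)\<^sup>2 \<le> lasso_objective X y l c"
      unfolding lasso_objective_def by linarith
    then have "lasso_objective X y l 0 \<le> lasso_objective X y l c"
      by (simp add: lasso_objective_def)
    with b[of 0] R show ?thesis by simp
  qed (rule b)
  then show ?thesis by (auto simp: is_arg_min_linorder)
qed

lemma lasso_minimizes:
  fixes X :: "real^'p^'n"
  assumes "inj ((*v) X)" and "l \<ge> 0"
  shows "lasso_objective X y l (lasso X y l) \<le> lasso_objective X y l b"
  using someI_ex[OF lasso_minimizer_exists[OF assms, of y]]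
  unfolding lasso_def arg_min_def is_arg_min_linorder by blast

lemma residual_mono:
  fixes X :: "real^'p^'n"
  assumes inj: "inj ((*v) X)" and s: "0 \<le> s" and st: "s \<le> t"
  shows "(norm (y - lasso_fit X y s))\<^sup>2 \<le> (norm (y - lasso_fit X y t))\<^sup>2"
proof (cases "s = t")
  case False
  define P where "P b = (\<Sum>j\<in>UNIV. \<bar>b $ j\<bar>)" for b :: "real^'p"
  let ?a = "lasso X y s" and ?b = "lasso X y t"
  have 1: "(norm (y - X *v ?a))\<^sup>2 + s * P ?a \<le> (norm (y - X *v ?b))\<^sup>2 + s * P ?b"
    using lasso_minimizes[OF inj s] by (simp add: lasso_objective_def P_def)
  have 2: "(norm (y - X *v ?b))\<^sup>2 + t * P ?b \<le> (norm (y - X *v ?a))\<^sup>2 + t * P ?a"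
    using lasso_minimizes[OF inj order_trans[OF s st]] by (simp add: lasso_objective_def P_def)
  \<comment> \<open>Adding the two optimality inequalities cancels the residuals: the larger penalty
    yields the smaller l1 norm.\<close>
  have "(t - s) * P ?b \<le> (t - s) * P ?a"
    using 1 2 by (simp add: algebra_simps)
  then have "P ?b \<le> P ?a" using False st by simp
  then have "s * P ?b \<le> s * P ?a" using s by (rule mult_left_mono)
  with 1 show ?thesis unfolding lasso_fit_def by linarith
qed simp

text \<open>Strong convexity at the midpoint: the parallelogram law for the residuals gives the
  quadratic gain, and the l1 term is convex.\<close>

lemma lasso_objective_midpoint:
  fixes X :: "real^'p^'n"
  assumes "l \<ge> 0"
  shows "lasso_objective X y l ((1/2) *\<^sub>R (b + c)) \<le>
    (lasso_objective X y l b + lasso_objective X y l c) / 2 - (norm (X *v (c - b)))\<^sup>2 / 4"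
proof -
  let ?u = "y - X *v b" and ?v = "y - X *v c"
  have mid: "y - X *v ((1/2) *\<^sub>R (b + c)) = (1/2) *\<^sub>R (?u + ?v)"
    by (simp add: vec_eq_iff matrix_vector_mult_scaleR matrix_vector_right_distrib field_simps)
  have diff: "X *v (c - b) = ?u - ?v"
    by (simp add: matrix_vector_mult_diff_distrib)
  have parallelogram: "(norm ((1/2) *\<^sub>R (u + v)))\<^sup>2 =
      ((norm u)\<^sup>2 + (norm v)\<^sup>2) / 2 - (norm (u - v))\<^sup>2 / 4" for u v :: "real^'n"
    unfolding power2_norm_eq_inner
    by (simp add: inner_add inner_diff inner_commute[of v u] field_simps)
  have "(\<Sum>j\<in>UNIV. \<bar>((1/2) *\<^sub>R (b + c)) $ j\<bar>) \<le>
      ((\<Sum>j\<in>UNIV. \<bar>b $ j\<bar>) + (\<Sum>j\<in>UNIV. \<bar>c $ j\<bar>)) / 2"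
    unfolding sum.distrib[symmetric] sum_divide_distrib by (intro sum_mono) simp
  then have "l * (\<Sum>j\<in>UNIV. \<bar>((1/2) *\<^sub>R (b + c)) $ j\<bar>) \<le>
      l * (((\<Sum>j\<in>UNIV. \<bar>b $ j\<bar>) + (\<Sum>j\<in>UNIV. \<bar>c $ j\<bar>)) / 2)"
    using assms by (rule mult_left_mono)
  then show ?thesis
    unfolding lasso_objective_def mid diff parallelogram times_divide_eq_right distrib_left
    by argo
qed

text \<open>The minimum is at most the value at the midpoint of the minimizer and \<open>c\<close>;
  inserting the midpoint bound and doubling gives the claim.\<close>

lemma lasso_objective_quadratic_growth:
  fixes X :: "real^'p^'n"
  assumes "inj ((*v) X)" and "l \<ge> 0"
  shows "lasso_objective X y l (lasso X y l) + (norm (X *v (c - lasso X y l)))\<^sup>2 / 2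
    \<le> lasso_objective X y l c"
  using lasso_minimizes[OF assms, of y "(1/2) *\<^sub>R (lasso X y l + c)"]
    lasso_objective_midpoint[OF assms(2), of X y "lasso X y l" c]
  by argo

lemma lasso_lipschitz:
  fixes X :: "real^'p^'n"
  assumes inj: "inj ((*v) X)"
  shows "\<exists>C. C-lipschitz_on {0..} (lasso X y)"
proof -
  obtain B where B: "B > 0" "\<And>v. B * norm v \<le> norm (X *v v)"
    using linear_inj_bounded_below_pos[OF matrix_vector_mul_linear inj] by blast
  \<comment> \<open>The factor \<open>CARD('p)\<close> comes from bounding the l1 norm by the
    Euclidean norm, and the factor \<open>B\<^sup>2\<close> from the lower bound on
    \<open>X\<close>.\<close>
  define C where "C = real CARD('p) / B\<^sup>2"
  have "dist (lasso X y s) (lasso X y t) \<le> C * dist s t" if s: "0 \<le> s" and t: "0 \<le> t" for s t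
  proof -
    define P where "P b = (\<Sum>j\<in>UNIV. \<bar>b $ j\<bar>)" for b :: "real^'p"
    let ?a = "lasso X y s" and ?b = "lasso X y t"
    have "\<bar>P ?b - P ?a\<bar> \<le> (\<Sum>j\<in>UNIV. \<bar>(?b - ?a) $ j\<bar>)"
      unfolding P_def sum_subtractf[symmetric]
      by (rule order_trans[OF sum_abs]) (auto intro: sum_mono)
    also have "\<dots> \<le> real CARD('p) * norm (?b - ?a)"
      using sum_bounded_above[of UNIV "\<lambda>j. \<bar>(?b - ?a) $ j\<bar>" "norm (?b - ?a)"]
      by (simp only: component_le_norm_cart)
    finally have P: "\<bar>P ?b - P ?a\<bar> \<le> real CARD('p) * norm (?b - ?a)" .
    have "(B * norm (?b - ?a))\<^sup>2 \<le> (norm (X *v (?b - ?a)))\<^sup>2"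
      using B by (intro power_mono) auto
    \<comment> \<open>Quadratic growth at \<open>s\<close> and at \<open>t\<close>, each tested
      against the other minimizer: in the sum the squared residuals cancel.\<close>
    also have "\<dots> \<le> (s - t) * (P ?b - P ?a)"
      using lasso_objective_quadratic_growth[OF inj s, of y ?b]
        lasso_objective_quadratic_growth[OF inj t, of y ?a]
        norm_minus_commute[of "X *v ?a" "X *v ?b"]
      by (simp add: lasso_objective_def P_def algebra_simps matrix_vector_mult_diff_distrib)
    also have "\<dots> \<le> \<bar>s - t\<bar> * \<bar>P ?b - P ?a\<bar>"
      by (metis abs_ge_self abs_mult)
    also have "\<dots> \<le> \<bar>s - t\<bar> * (real CARD('p) * norm (?b - ?a))"
      using P by (intro mult_left_mono) auto
    finally have "norm (?b - ?a) * (B\<^sup>2 * norm (?b - ?a)) \<le>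
        norm (?b - ?a) * (real CARD('p) * \<bar>s - t\<bar>)"
      by (simp add: power2_eq_square algebra_simps)
    \<comment> \<open>The left side is quadratic in the distance and the right side linear, so one
      factor cancels.\<close>
    then have "B\<^sup>2 * norm (?b - ?a) \<le> real CARD('p) * \<bar>s - t\<bar>"
      by (cases "?b = ?a") auto
    then show ?thesis
      using B(1) by (simp add: C_def dist_norm norm_minus_commute field_simps)
  qed
  moreover have "C \<ge> 0" by (simp add: C_def)
  ultimately show ?thesis by (auto intro!: exI[of _ C] lipschitz_onI)
qed

text \<open>Being nonzero is an open condition and there are finitely many coordinates. Only the
  right side of \<open>t\<close> is used, since at \<open>t = 0\<close> the values to the left are
  arbitrary.\<close>

lemma active_set_eventually_superset:
  fixes X :: "real^'p^'n"
  assumes "inj ((*v) X)" and "t \<ge> 0"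
  shows "\<forall>\<^sub>F s in at_right t. active_set X y t \<subseteq> active_set X y s"
proof -
  have "continuous_on {0..} (lasso X y)"
    using lasso_lipschitz[OF assms(1)] lipschitz_on_continuous_on by blast
  then have lim: "(lasso X y \<longlongrightarrow> lasso X y t) (at_right t)"
    using assms(2) by (auto simp: continuous_on_def intro: tendsto_within_subset)
  have "\<forall>\<^sub>F s in at_right t. lasso X y t $ j \<noteq> 0 \<longrightarrow> lasso X y s $ j \<noteq> 0" for j
  proof (cases "lasso X y t $ j = 0")
    case False
    then show ?thesis
      using tendsto_imp_eventually_ne[OF tendsto_vec_nth[OF lim], of j 0] by simp
  qed simp
  then have "\<forall>\<^sub>F s in at_right t. \<forall>j. lasso X y t $ j \<noteq> 0 \<longrightarrow> lasso X y s $ j \<noteq> 0"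
    by (intro eventually_all_finite) auto
  then show ?thesis
    by (rule eventually_mono) (auto simp: active_set_def)
qed

text \<open>A locally constant function on a connected set is constant. The interval omits
  \<open>t\<close>, which may itself be a transition point.\<close>

lemma active_set_eq_without_transition:
  assumes "t \<ge> 0" and "{t<..l} \<inter> transition_points X y = {}" and "s \<in> {t<..l}"
  shows "active_set X y s = active_set X y l"
proof (rule connected_local_const[of "{t<..l}"])
  show "\<forall>a\<in>{t<..l}. \<forall>\<^sub>F b in at a within {t<..l}. active_set X y a = active_set X y b"
  proof
    fix a assume a: "a \<in> {t<..l}"
    then have "a > 0" and "a \<notin> transition_points X y"
      using assms(1,2) by auto
    then obtain U where U: "open U" "a \<in> U" "active_set X y constant_on U"
      by (auto simp: transition_points_def)
    then show "\<forall>\<^sub>F b in at a within {t<..l}. active_set X y a = active_set X y b"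
      unfolding eventually_at_topological constant_on_def by metis
  qed
qed (use assms(3) in auto)

lemma lasso_criterion_le_at_transition_point:
  fixes X :: "real^'p^'n"
  assumes inj: "inj ((*v) X)" and fin: "finite (transition_points X y)"
    and w: "w \<ge> 0" and l: "l \<ge> 0"
  shows "\<exists>t\<in>transition_points X y. lasso_criterion X y \<sigma> w t \<le> lasso_criterion X y \<sigma> w l"
proof -
  define t where "t = Max (transition_points X y \<inter> {..l})"
  \<comment> \<open>The point 0 always belongs to this set, so the maximum is meaningful.\<close>
  have ne: "transition_points X y \<inter> {..l} \<noteq> {}"
    using l by (auto simp: transition_points_def)
  have t: "t \<in> transition_points X y \<inter> {..l}"
    unfolding t_def using fin ne by (intro Max_in) auto
  then have t0: "t \<ge> 0" by (auto simp: transition_points_def)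
  have gap: "{t<..l} \<inter> transition_points X y = {}"
  proof -
    have "s \<le> t" if "s \<in> transition_points X y" "s \<le> l" for s
      unfolding t_def using fin that by (intro Max_ge) auto
    then show ?thesis by fastforce
  qed
  have "active_set X y t \<subseteq> active_set X y l"
  proof (cases "t = l")
    case False
    then have "t < l" using t by simp
    have "\<forall>\<^sub>F s in at_right t. s \<in> {t<..l}"
      using \<open>t < l\<close> by (auto simp: eventually_at_right_field intro!: exI[of _ l])
    then have "\<forall>\<^sub>F s in at_right t. s \<in> {t<..l} \<and> active_set X y t \<subseteq> active_set X y s"
      using active_set_eventually_superset[OF inj t0] by (rule eventually_conj)
    \<comment> \<open>The inclusion is known only near \<open>t\<close>; constancy of the active set
      on the gap carries it from \<open>s\<close> to \<open>l\<close>.\<close>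
    from eventually_happens'[OF trivial_limit_at_right_real this]
    obtain s where s: "s \<in> {t<..l}" "active_set X y t \<subseteq> active_set X y s"
      by auto
    from s(2) show ?thesis unfolding active_set_eq_without_transition[OF t0 gap s(1)] .
  qed simp
  then have "df_hat X y t \<le> df_hat X y l"
    unfolding df_hat_def by (intro card_mono) auto
  then have "lasso_criterion X y \<sigma> w t \<le> lasso_criterion X y \<sigma> w l"
    unfolding lasso_criterion_def using t w residual_mono[OF inj t0, of l y]
    by (intro add_mono divide_right_mono mult_left_mono) auto
  with t show ?thesis by blast
qed

theorem theorem3:
  fixes X :: "real^'p^'n" and y :: "real^'n" and \<sigma> w :: real
    and lam :: "nat \<Rightarrow> real" and K mstar :: nat
  assumes "rank X = CARD('p)"
    and "\<sigma>\<^sup>2 > 0"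
    and "w = 2 \<or> w = ln (real CARD('n))"
    and "strict_antimono_on {0..K} lam"
    and "lam K = 0"
    and "lam ` {0..K} = transition_points X y"
    and "is_arg_min (\<lambda>m. lasso_criterion X y \<sigma> w (lam m)) (\<lambda>m. m \<in> {0..K}) mstar"
  shows "is_arg_min (lasso_criterion X y \<sigma> w) (\<lambda>l. l \<ge> 0) (lam mstar)"
proof -
  have inj: "inj ((*v) X)"
    using assms(1) by (simp add: full_rank_injective)
  \<comment> \<open>In the BIC case this is \<open>ln n \<ge> 0\<close>, as the index type has at
    least one element.\<close>
  have w: "w \<ge> 0"
    using assms(3) one_le_card_finite[where 'a = 'n] by auto
  have fin: "finite (transition_points X y)"
    unfolding assms(6)[symmetric] by simp
  have m: "mstar \<in> {0..K}"
    and min: "\<And>m. m \<in> {0..K} \<Longrightarrow>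
      lasso_criterion X y \<sigma> w (lam mstar) \<le> lasso_criterion X y \<sigma> w (lam m)"
    using assms(7) by (auto simp: is_arg_min_linorder)
  have "lam mstar \<in> transition_points X y" using m assms(6) by blast
  then have "lam mstar \<ge> 0" by (auto simp: transition_points_def)
  moreover have "lasso_criterion X y \<sigma> w (lam mstar) \<le> lasso_criterion X y \<sigma> w l" if l: "l \<ge> 0" for l
  proof -
    obtain t where "t \<in> transition_points X y"
      and le: "lasso_criterion X y \<sigma> w t \<le> lasso_criterion X y \<sigma> w l"
      using lasso_criterion_le_at_transition_point[OF inj fin w l] by blast
    then obtain m where "m \<in> {0..K}" "t = lam m" using assms(6) by blast
    with min le show ?thesis by fastforce
  qed
  ultimately show ?thesis by (simp add: is_arg_min_linorder)
qed

end
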